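(* Consider the storage-investment game $G=\langle \mathcal{I},(\mathcal{X}_i)_{i\in\mathcal{I}},(f_i)_{i\in\mathcal{I}}\rangle$ defined in the context, in which the market price is the linear function $\pi^\omega[t](\bm{x}_1,\dots,\bm{x}_I)=\pi_0^\omega[t]-a^\omega[t]\sum_{i\in\mathcal{I}}\big(-p_i^{ch,\omega}[t]+p_i^{dis,\omega}[t]\big)$ for all $t\in\mathcal{T}$, $\omega\in\Omega$. For $i,j\in\mathcal{I}$, $t\in\mathcal{T}$, $\omega\in\Omega$ put $$A_t^\omega(\bm{x}_i,\bm{x}_j):=\big(-p_i^{ch,\omega}[t]+p_i^{dis,\omega}[t]\big)\cdot\big(-p_j^{ch,\omega}[t]+p_j^{dis,\omega}[t]\big),$$ and consider the optimization problem $$\max_{\bm{x}}\ \sum_{i\in\mathcal{I}}f_i(\bm{x})+\mathbb{E}_{\omega\in\Omega}\Big[\sum_{t\in\mathcal{T}}\sum_{1\le i<j\le I}a^\omega[t]\cdot A_t^\omega(\bm{x}_i,\bm{x}_j)\Big]\quad\text{s.t. } \bm{x}_i\in\mathcal{X}_i\ \ \forall i\in\mathcal{I}.$$ Then this problem is a convex optimization problem (maximization of a concave function over a convex set), and a strategy profile $\bm{x}^*\in\prod_{i\in\mathcal{I}}\mathcal{X}_i$ is a pure strategy Nash equilibrium of $G$ if and only if $\bm{x}^*$ is an optimal solution of this problem.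
   Context: Data. $\mathcal{I}=\{1,\dots,I\}$ is a finite set of investors, $\mathcal{T}=\{1,\dots,T\}$ a finite set of time slots, $\mathcal{T}'=\{0\}\cup\mathcal{T}$, and $\Omega$ a finite set of scenarios with probabilities $\rho^\omega\ge 0$, $\sum_{\omega\in\Omega}\rho^\omega=1$; for a real-valued function $Y$ on $\Omega$, $\mathbb{E}_{\omega\in\Omega}[Y^\omega]=\sum_{\omega\in\Omega}\rho^\omega Y^\omega$. For each $t\in\mathcal{T}$, $\omega\in\Omega$, $\pi_0^\omega[t]\in\mathbb{R}$ is the original market price (without storage) and $a^\omega[t]>0$ is the slope of the price function. For each investor $i$: unit investment costs $c_i^S,c_i^P\ge 0$, unit operation costs $c_i^{ch},c_i^{dis}\ge 0$, charge and discharge efficiencies $\eta_i^c,\eta_i^d\in(0,1]$, and duration bounds $0\le\underline{\alpha}_i\le\overline{\alpha}_i<\infty$. $\kappa>0$ is a constant scaling factor. Strategies. The decision vector of investor $i$ is the real vector $\bm{x}_i=\big(S_i,P_i,(p_i^{ch,\omega}[t])_{t\in\mathcal{T},\omega\in\Omega},(p_i^{dis,\omega}[t])_{t\in\mathcal{T},\omega\in\Omega},(e_i^\omega[t])_{t\in\mathcal{T}',\omega\in\Omega}\big)$ (energy capacity, power rating, charge amounts, discharge amounts, energy levels). The strategy set $\mathcal{X}_i$ is the set of all such $\bm{x}_i$ satisfying, for all $\omega\in\Omega$: - $0\le p_i^{dis,\omega}[t]\le P_i$ and $0\le p_i^{ch,\omega}[t]\le P_i$ for all $t\in\mathcal{T}$;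 - $e_i^\omega[t]=e_i^\omega[t-1]+\eta_i^c\,p_i^{ch,\omega}[t]-p_i^{dis,\omega}[t]/\eta_i^d$ for all $t\in\mathcal{T}$; - $0\le e_i^\omega[t]\le S_i$ for all $t\in\mathcal{T}'$; - $e_i^\omega[0]=e_i^\omega[T]$; - $\underline{\alpha}_iP_i\le S_i\le\overline{\alpha}_iP_i$ (so zero investment $S_i=P_i=0$ is allowed). Profits. Write $\bm{x}=(\bm{x}_1,\dots,\bm{x}_I)$ and let $\bm{x}_{-i}$ denote the decisions of all investors other than $i$. With the market price $\pi^\omega[t](\bm{x})$ given in the claim, investor $i$'s profit is $$f_i(\bm{x})=f_i(\bm{x}_i,\bm{x}_{-i})=\mathbb{E}_{\omega\in\Omega}\Big[\sum_{t\in\mathcal{T}}\big(-p_i^{ch,\omega}[t]+p_i^{dis,\omega}[t]\big)\,\pi^\omega[t](\bm{x})\Big]-\big(\kappa c_i^SS_i+\kappa c_i^PP_i\big)-\mathbb{E}_{\omega\in\Omega}\Big[\sum_{t\in\mathcal{T}}\big(c_i^{ch}p_i^{ch,\omega}[t]+c_i^{dis}p_i^{dis,\omega}[t]\big)\Big].$$ In the game $G$ the players are the investors, who simultaneously choose $\bm{x}_i\in\mathcal{X}_i$ to maximize $f_i$. Nash equilibrium. A profile $\bm{x}^*\in\prod_{i\in\mathcal{I}}\mathcal{X}_i$ is a pure strategy Nash equilibrium of $G$ if for every $i\in\mathcal{I}$ and every $\bm{x}_i\in\mathcal{X}_i$, $f_i(\bm{x}_i^*,\bm{x}_{-i}^*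 )\ge f_i(\bm{x}_i,\bm{x}_{-i}^* )$. *)

theory Defs
  imports "HOL-Analysis.Analysis" "HOL-Library.Function_Algebras"
begin

text \<open>
  Functions into a real vector space form a real vector space under pointwise operations
  (addition comes from \<^theory>\<open>HOL-Library.Function_Algebras\<close>). This lets the library's
  \<^const>\<open>convex\<close> and \<^const>\<open>concave_on\<close> apply to families of reals and to strategy profiles.
\<close>

instantiation "fun" :: (type, scaleR) scaleR
begin

definition scaleR_fun :: "real \<Rightarrow> ('a \<Rightarrow> 'b) \<Rightarrow> 'a \<Rightarrow> 'b" where
  "scaleR_fun r f = (\<lambda>x. r *\<^sub>R f x)"

instance ..

end

instance "fun" :: (type, real_vector) real_vector
  by standard (simp_all add: scaleR_fun_def plus_fun_def fun_eq_iff algebra_simps)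

text \<open>
  Investors are \<open>1, \<dots>, I\<close>, time slots are \<open>1, \<dots>, T\<close>, and the scenarios are all elements of the
  finite type \<open>'w\<close>. Values of the fields at investor or slot indices outside these ranges are
  irrelevant.
\<close>

record 'w storage_game =
  num_investors :: nat  \<comment> \<open>\<open>I\<close>\<close>
  horizon :: nat  \<comment> \<open>\<open>T\<close>\<close>
  prob :: "'w \<Rightarrow> real"  \<comment> \<open>\<open>\<rho>\<close>\<close>
  base_price :: "nat \<Rightarrow> 'w \<Rightarrow> real"  \<comment> \<open>\<open>\<pi>\<^sub>0\<close>\<close>
  slope :: "nat \<Rightarrow> 'w \<Rightarrow> real"  \<comment> \<open>\<open>a\<close>\<close>
  cost_S :: "nat \<Rightarrow> real"
  cost_P :: "nat \<Rightarrow> real"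
  cost_ch :: "nat \<Rightarrow> real"
  cost_dis :: "nat \<Rightarrow> real"
  eff_c :: "nat \<Rightarrow> real"  \<comment> \<open>\<open>\<eta>\<^sup>c\<close>\<close>
  eff_d :: "nat \<Rightarrow> real"  \<comment> \<open>\<open>\<eta>\<^sup>d\<close>\<close>
  dur_lo :: "nat \<Rightarrow> real"  \<comment> \<open>lower duration bound\<close>
  dur_hi :: "nat \<Rightarrow> real"  \<comment> \<open>upper duration bound\<close>
  scaling :: real  \<comment> \<open>\<open>\<kappa>\<close>\<close>

definition investors :: "'w storage_game \<Rightarrow> nat set" where
  "investors G = {1..num_investors G}"

definition slots :: "'w storage_game \<Rightarrow> nat set" where
  "slots G = {1..horizon G}"

definition slots0 :: "'w storage_game \<Rightarrow> nat set" where
  "slots0 G = {0} \<union> slots G"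

definition storage_game :: "('w::finite) storage_game \<Rightarrow> bool" where
  "storage_game G \<longleftrightarrow>
     (\<forall>\<omega>. prob G \<omega> \<ge> 0) \<and> (\<Sum>\<omega>\<in>UNIV. prob G \<omega>) = 1 \<and>
     (\<forall>t\<in>slots G. \<forall>\<omega>. slope G t \<omega> > 0) \<and>
     (\<forall>i\<in>investors G.
        cost_S G i \<ge> 0 \<and> cost_P G i \<ge> 0 \<and> cost_ch G i \<ge> 0 \<and> cost_dis G i \<ge> 0 \<and>
        eff_c G i \<in> {0<..1} \<and> eff_d G i \<in> {0<..1} \<and>
        0 \<le> dur_lo G i \<and> dur_lo G i \<le> dur_hi G i) \<and>
     scaling G > 0"

definition expect :: "('w::finite) storage_game \<Rightarrow> ('w \<Rightarrow> real) \<Rightarrow> real" where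
  "expect G Y = (\<Sum>\<omega>\<in>UNIV. prob G \<omega> * Y \<omega>)"

text \<open>
  A decision vector \<open>(S, P, p\<^sup>c\<^sup>h, p\<^sup>d\<^sup>i\<^sup>s, e)\<close>; the three families take the slot first and the
  scenario second.
\<close>

type_synonym 'w strategy =
  "real \<times> real \<times> (nat \<Rightarrow> 'w \<Rightarrow> real) \<times> (nat \<Rightarrow> 'w \<Rightarrow> real) \<times> (nat \<Rightarrow> 'w \<Rightarrow> real)"

type_synonym 'w profile = "nat \<Rightarrow> 'w strategy"

definition energy_capacity :: "'w strategy \<Rightarrow> real" where
  "energy_capacity = (\<lambda>(S, P, ch, dis, e). S)"

definition power_rating :: "'w strategy \<Rightarrow> real" where
  "power_rating = (\<lambda>(S, P, ch, dis, e). P)"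

definition charge :: "'w strategy \<Rightarrow> nat \<Rightarrow> 'w \<Rightarrow> real" where
  "charge = (\<lambda>(S, P, ch, dis, e). ch)"

definition discharge :: "'w strategy \<Rightarrow> nat \<Rightarrow> 'w \<Rightarrow> real" where
  "discharge = (\<lambda>(S, P, ch, dis, e). dis)"

definition energy_level :: "'w strategy \<Rightarrow> nat \<Rightarrow> 'w \<Rightarrow> real" where
  "energy_level = (\<lambda>(S, P, ch, dis, e). e)"

definition net_discharge :: "'w strategy \<Rightarrow> nat \<Rightarrow> 'w \<Rightarrow> real" where
  "net_discharge x t \<omega> = - charge x t \<omega> + discharge x t \<omega>"

text \<open>
  The \<^const>\<open>extensional\<close> conditions only fix the coordinates at slot indices that do not belong
  to the decision vector.
\<close>

definition strategy_set :: "'w storage_game \<Rightarrow> nat \<Rightarrow> 'w strategy set" where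
  "strategy_set G i = {x.
     charge x \<in> extensional (slots G) \<and>
     discharge x \<in> extensional (slots G) \<and>
     energy_level x \<in> extensional (slots0 G) \<and>
     (\<forall>\<omega>.
       (\<forall>t\<in>slots G. 0 \<le> discharge x t \<omega> \<and> discharge x t \<omega> \<le> power_rating x \<and>
                     0 \<le> charge x t \<omega> \<and> charge x t \<omega> \<le> power_rating x) \<and>
       (\<forall>t\<in>slots G. energy_level x t \<omega> =
          energy_level x (t - 1) \<omega> + eff_c G i * charge x t \<omega> - discharge x t \<omega> / eff_d G i) \<and>
       (\<forall>t\<in>slots0 G. 0 \<le> energy_level x t \<omega> \<and> energy_level x t \<omega> \<le> energy_capacity x) \<and>
       energy_level x 0 \<omega> = energy_level x (horizon G) \<omega>) \<and>
     dur_lo G i * power_rating x \<le> energy_capacity x \<and> energy_capacity x \<le> dur_hi G i * power_rating x}"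

definition price :: "'w storage_game \<Rightarrow> 'w profile \<Rightarrow> nat \<Rightarrow> 'w \<Rightarrow> real" where
  "price G x t \<omega> =
     base_price G t \<omega> - slope G t \<omega> * (\<Sum>i\<in>investors G. net_discharge (x i) t \<omega>)"

definition profit :: "('w::finite) storage_game \<Rightarrow> nat \<Rightarrow> 'w profile \<Rightarrow> real" where
  "profit G i x =
     expect G (\<lambda>\<omega>. \<Sum>t\<in>slots G. net_discharge (x i) t \<omega> * price G x t \<omega>)
     - (scaling G * cost_S G i * energy_capacity (x i) + scaling G * cost_P G i * power_rating (x i))
     - expect G (\<lambda>\<omega>. \<Sum>t\<in>slots G.
         cost_ch G i * charge (x i) t \<omega> + cost_dis G i * discharge (x i) t \<omega>)"

definition profiles :: "'w storage_game \<Rightarrow> 'w profile set" where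
  "profiles G = Pi\<^sub>E (investors G) (strategy_set G)"

definition pure_nash :: "('w::finite) storage_game \<Rightarrow> 'w profile \<Rightarrow> bool" where
  "pure_nash G x \<longleftrightarrow> x \<in> profiles G \<and>
     (\<forall>i\<in>investors G. \<forall>y\<in>strategy_set G i. profit G i x \<ge> profit G i (x(i := y)))"

definition cross_term :: "'w strategy \<Rightarrow> 'w strategy \<Rightarrow> nat \<Rightarrow> 'w \<Rightarrow> real" where
  "cross_term x y t \<omega> = net_discharge x t \<omega> * net_discharge y t \<omega>"

definition objective :: "('w::finite) storage_game \<Rightarrow> 'w profile \<Rightarrow> real" where
  "objective G x =
     (\<Sum>i\<in>investors G. profit G i x) +
     expect G (\<lambda>\<omega>. \<Sum>t\<in>slots G.
       \<Sum>(i, j)\<in>{(i, j). 1 \<le> i \<and> i < j \<and> j \<le> num_investors G}.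
         slope G t \<omega> * cross_term (x i) (x j) t \<omega>)"

end

theory Submission
  imports Defs
begin

text \<open>
  The objective is an exact potential of the game, and both it and the profits are quadratic. With
  \<open>v\<^sub>i\<close> the change of investor \<open>i\<close>'s net discharge and \<open>L\<^sub>i\<close> the derivative of \<open>i\<close>'s profit in
  \<open>i\<close>'s own decision, a unilateral deviation changes the profit by \<open>L\<^sub>i - E[\<Sum>\<^sub>t a v\<^sub>i\<^sup>2]\<close>, while a joint
  deviation changes the objective by \<open>\<Sum>\<^sub>i L\<^sub>i - E[\<Sum>\<^sub>t a ((\<Sum>\<^sub>i v\<^sub>i)\<^sup>2 + \<Sum>\<^sub>i v\<^sub>i\<^sup>2)] / 2\<close>. The second formula
  gives concavity and the potential property. At an equilibrium, scaling a deviation by \<open>s \<rightarrow> 0\<close> in the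
  first formula gives \<open>L\<^sub>i \<le> 0\<close> for all \<open>i\<close>, and then the second one gives optimality.
\<close>

section \<open>Convexity of the feasible set\<close>

text \<open>Off \<open>A\<close> both functions take the value \<open>undefined\<close>, and weights
  with sum 1 combine two copies of it into itself.\<close>

lemma convex_extensional: "convex (extensional A :: ('a \<Rightarrow> 'b::real_vector) set)"
  unfolding convex_def extensional_def
  by (auto simp: scaleR_fun_def scaleR_left_distrib[symmetric])

lemma convex_PiE:
  fixes S :: "'a \<Rightarrow> ('b::real_vector) set"
  assumes "\<And>i. i \<in> A \<Longrightarrow> convex (S i)"
  shows "convex (Pi\<^sub>E A S)"
proof -
  have "convex (Pi A S)"
    unfolding convex_def
    using assms by (auto simp: scaleR_fun_def Pi_iff intro!: convexD)
  then show ?thesis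
    unfolding PiE_def by (intro convex_Int convex_extensional)
qed

text \<open>Serves to trade the sum over pairs in \<open>objective\<close> for squares, whose sign
  is visible.\<close>

lemma sum_square_pairs:
  fixes d :: "nat \<Rightarrow> real"
  shows "(\<Sum>i\<in>{1..n}. d i)\<^sup>2 =
    (\<Sum>i\<in>{1..n}. (d i)\<^sup>2) + 2 * (\<Sum>(i, j)\<in>{(i, j). 1 \<le> i \<and> i < j \<and> j \<le> n}. d i * d j)"
proof (induction n)
  case 0
  have "{(i, j). 1 \<le> i \<and> i < j \<and> j \<le> (0::nat)} = {}" by auto
  then show ?case by (simp only:) simp
next
  case (Suc n)
  let ?P = "\<lambda>n. {(i, j). 1 \<le> i \<and> i < j \<and> j \<le> (n::nat)}"
  \<comment> \<open>The new pairs are those whose larger index is \<open>Suc n\<close>.\<close>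
  have P: "?P (Suc n) = ?P n \<union> (\<lambda>i. (i, Suc n)) ` {1..n}" by (auto simp: le_Suc_eq)
  have "finite (?P n)" by (rule finite_subset[of _ "{..n} \<times> {..n}"]) auto
  then have "(\<Sum>(i, j)\<in>?P (Suc n). d i * d j) =
      (\<Sum>(i, j)\<in>?P n. d i * d j) + (\<Sum>(i, j)\<in>(\<lambda>i. (i, Suc n)) ` {1..n}. d i * d j)"
    unfolding P by (intro sum.union_disjoint) auto
  also have "(\<Sum>(i, j)\<in>(\<lambda>i. (i, Suc n)) ` {1..n}. d i * d j) = (\<Sum>i\<in>{1..n}. d i) * d (Suc n)"
    by (subst sum.reindex) (auto simp: inj_on_def sum_distrib_right)
  finally show ?case
    using Suc.IH by (simp add: power2_sum algebra_simps)
qed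

lemma strategy_components_affine:
  "energy_capacity (u *\<^sub>R x + v *\<^sub>R y) = u * energy_capacity x + v * energy_capacity y"
  "power_rating (u *\<^sub>R x + v *\<^sub>R y) = u * power_rating x + v * power_rating y"
  "charge (u *\<^sub>R x + v *\<^sub>R y) t \<omega> = u * charge x t \<omega> + v * charge y t \<omega>"
  "discharge (u *\<^sub>R x + v *\<^sub>R y) t \<omega> = u * discharge x t \<omega> + v * discharge y t \<omega>"
  "energy_level (u *\<^sub>R x + v *\<^sub>R y) t \<omega> = u * energy_level x t \<omega> + v * energy_level y t \<omega>"
  "net_discharge (u *\<^sub>R x + v *\<^sub>R y) t \<omega> = u * net_discharge x t \<omega> + v * net_discharge y t \<omega>"
  by (simp_all add: energy_capacity_def power_rating_def charge_def discharge_def energy_level_def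
      net_discharge_def scaleR_fun_def split_beta algebra_simps)

lemma strategy_families_affine:
  "charge (u *\<^sub>R x + v *\<^sub>R y) = u *\<^sub>R charge x + v *\<^sub>R charge y"
  "discharge (u *\<^sub>R x + v *\<^sub>R y) = u *\<^sub>R discharge x + v *\<^sub>R discharge y"
  "energy_level (u *\<^sub>R x + v *\<^sub>R y) = u *\<^sub>R energy_level x + v *\<^sub>R energy_level y"
  by (simp_all add: charge_def discharge_def energy_level_def split_beta)

lemma convex_strategy_set: "convex (strategy_set G i)"
proof (rule convexI)
  fix x y and u v :: real
  assume x: "x \<in> strategy_set G i" and y: "y \<in> strategy_set G i"
    and uv: "0 \<le> u" "0 \<le> v" "u + v = 1"
  let ?z = "u *\<^sub>R x + v *\<^sub>R y"
  have comb_mono: "u * a + v * b \<le> u * a' + v * b'" if "a \<le> a'" "b \<le> b'" for a b a' b' :: real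
    using that uv by (intro add_mono mult_left_mono)
  have comb_nonneg: "0 \<le> u * a + v * b" if "0 \<le> a" "0 \<le> b" for a b :: real
    using that uv by simp
  have ext: "charge ?z \<in> extensional (slots G)" "discharge ?z \<in> extensional (slots G)"
    "energy_level ?z \<in> extensional (slots0 G)"
    unfolding strategy_families_affine
    using x y uv by (auto simp: strategy_set_def intro!: convexD[OF convex_extensional])
  have dur: "dur_lo G i * power_rating ?z \<le> energy_capacity ?z"
    "energy_capacity ?z \<le> dur_hi G i * power_rating ?z"
    using comb_mono[of "dur_lo G i * power_rating x" "energy_capacity x"
        "dur_lo G i * power_rating y" "energy_capacity y"]
      comb_mono[of "energy_capacity x" "dur_hi G i * power_rating x"
        "energy_capacity y" "dur_hi G i * power_rating y"] x y
    by (auto simp: strategy_set_def strategy_components_affine algebra_simps)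
  have dyn: "energy_level ?z t \<omega> =
      energy_level ?z (t - 1) \<omega> + eff_c G i * charge ?z t \<omega> - discharge ?z t \<omega> / eff_d G i"
    if "t \<in> slots G" for t \<omega>
  proof -
    have "energy_level x t \<omega> =
        energy_level x (t - 1) \<omega> + eff_c G i * charge x t \<omega> - discharge x t \<omega> / eff_d G i"
      "energy_level y t \<omega> =
        energy_level y (t - 1) \<omega> + eff_c G i * charge y t \<omega> - discharge y t \<omega> / eff_d G i"
      using x y that by (auto simp: strategy_set_def)
    then show ?thesis
      unfolding strategy_components_affine
      by (simp only:) (simp add: algebra_simps add_divide_distrib)
  qed
  show "?z \<in> strategy_set G i"
    unfolding strategy_set_def
    using x y ext dur dyn
    by (auto simp: strategy_set_def strategy_components_affine intro!: comb_mono comb_nonneg)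
qed

lemma convex_profiles: "convex (profiles G)"
  unfolding profiles_def by (intro convex_PiE convex_strategy_set)

section \<open>Expected totals, costs and unilateral profit changes\<close>

definition total :: "('w::finite) storage_game \<Rightarrow> (nat \<Rightarrow> 'w \<Rightarrow> real) \<Rightarrow> real" where
  "total G h = expect G (\<lambda>\<omega>. \<Sum>t\<in>slots G. h t \<omega>)"

lemma total_add: "total G (\<lambda>t \<omega>. h t \<omega> + k t \<omega>) = total G h + total G k"
  by (simp add: total_def expect_def sum.distrib algebra_simps)

lemma total_diff: "total G (\<lambda>t \<omega>. h t \<omega> - k t \<omega>) = total G h - total G k"
  by (simp add: total_def expect_def sum_subtractf algebra_simps)

lemma total_cmult: "total G (\<lambda>t \<omega>. c * h t \<omega>) = c * total G h"
  by (simp add: total_def expect_def sum_distrib_left algebra_simps)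

lemma total_sum: "total G (\<lambda>t \<omega>. \<Sum>i\<in>A. h i t \<omega>) = (\<Sum>i\<in>A. total G (h i))"
proof (induction A rule: infinite_finite_induct)
  case (insert i A)
  then show ?case by (simp add: total_add)
qed (simp_all add: total_def expect_def)

lemma total_cong:
  assumes "\<And>t \<omega>. t \<in> slots G \<Longrightarrow> h t \<omega> = k t \<omega>"
  shows "total G h = total G k"
  using assms by (simp add: total_def expect_def)

lemma total_nonneg:
  assumes "storage_game G" "\<And>t \<omega>. t \<in> slots G \<Longrightarrow> 0 \<le> h t \<omega>"
  shows "0 \<le> total G h"
  using assms by (auto simp: total_def expect_def storage_game_def intro!: sum_nonneg mult_nonneg_nonneg)

text \<open>Collects the part of the profit that is linear in the investor's own decision and
  independent of the others; it never contributes to second-order terms.\<close>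

definition cost :: "('w::finite) storage_game \<Rightarrow> nat \<Rightarrow> 'w strategy \<Rightarrow> real" where
  "cost G i x = scaling G * cost_S G i * energy_capacity x + scaling G * cost_P G i * power_rating x
     + total G (\<lambda>t \<omega>. cost_ch G i * charge x t \<omega> + cost_dis G i * discharge x t \<omega>)"

lemma cost_affine: "cost G i (u *\<^sub>R x + v *\<^sub>R y) = u * cost G i x + v * cost G i y"
  unfolding cost_def strategy_components_affine total_add total_cmult
  by (simp add: total_add total_cmult algebra_simps)

lemma profit_eq: "profit G i x = total G (\<lambda>t \<omega>. net_discharge (x i) t \<omega> * price G x t \<omega>) - cost G i (x i)"
  by (simp add: profit_def total_def cost_def)

text \<open>
  The directional derivative of investor \<open>i\<close>'s profit at \<open>x\<close> towards \<open>z\<close>; the summand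
  \<open>- a d\<^sub>i\<close> next to the price is the investor's own price impact.
\<close>

definition own_derivative :: "('w::finite) storage_game \<Rightarrow> nat \<Rightarrow> 'w profile \<Rightarrow> 'w strategy \<Rightarrow> real" where
  "own_derivative G i x z =
     total G (\<lambda>t \<omega>. (net_discharge z t \<omega> - net_discharge (x i) t \<omega>) *
       (price G x t \<omega> - slope G t \<omega> * net_discharge (x i) t \<omega>))
     - (cost G i z - cost G i (x i))"

text \<open>A weighted squared seminorm of the change in net discharge: the second-order loss of a
  unilateral deviation.\<close>

definition quad :: "('w::finite) storage_game \<Rightarrow> 'w strategy \<Rightarrow> 'w strategy \<Rightarrow> real" where
  "quad G x z = total G (\<lambda>t \<omega>. slope G t \<omega> * (net_discharge z t \<omega> - net_discharge x t \<omega>)\<^sup>2)"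

lemma own_derivative_self: "own_derivative G i x (x i) = 0"
  by (simp add: own_derivative_def total_def expect_def)

lemma quad_self: "quad G x x = 0"
  by (simp add: quad_def total_def expect_def)

lemma quad_nonneg: "storage_game G \<Longrightarrow> 0 \<le> quad G x z"
  unfolding quad_def by (intro total_nonneg) (auto simp: storage_game_def less_imp_le)

text \<open>The weights must sum to 1 because the base point \<open>x i\<close> is subtracted: the
  map is affine in its last argument, not linear.\<close>

lemma own_derivative_affine:
  assumes "u + v = 1"
  shows "own_derivative G i x (u *\<^sub>R y + v *\<^sub>R z) = u * own_derivative G i x y + v * own_derivative G i x z"
proof -
  have u: "u = 1 - v" using assms by simp
  show ?thesis
    unfolding own_derivative_def cost_affine strategy_components_affine right_diff_distrib
      total_cmult[symmetric]
    unfolding u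
    by (simp add: total_add[symmetric] total_diff[symmetric] algebra_simps)
qed

lemma quad_towards: "quad G x ((1 - s) *\<^sub>R x + s *\<^sub>R z) = s\<^sup>2 * quad G x z"
  unfolding quad_def strategy_components_affine total_cmult[symmetric]
  by (intro total_cong) (simp add: power2_eq_square algebra_simps)

text \<open>The expansion is exact since profit is quadratic in the own decision: a change v of net
  discharge lowers the price by a v, which produces both the price impact a v d_i and the loss a
  v^2.\<close>

lemma profit_deviation:
  assumes "i \<in> investors G"
  shows "profit G i (x(i := z)) - profit G i x = own_derivative G i x z - quad G (x i) z"
proof -
  have "(\<Sum>j\<in>investors G. net_discharge ((x(i := z)) j) t \<omega>) =
      (\<Sum>j\<in>investors G. net_discharge (x j) t \<omega>) - net_discharge (x i) t \<omega> + net_discharge z t \<omega>"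
    for t \<omega>
  proof -
    have "(\<Sum>j\<in>investors G - {i}. net_discharge ((x(i := z)) j) t \<omega>) =
        (\<Sum>j\<in>investors G - {i}. net_discharge (x j) t \<omega>)"
      by (intro sum.cong) auto
    moreover have "finite (investors G)" by (simp add: investors_def)
    ultimately show ?thesis
      using sum.remove[OF _ assms, of "\<lambda>j. net_discharge ((x(i := z)) j) t \<omega>"]
        sum.remove[OF _ assms, of "\<lambda>j. net_discharge (x j) t \<omega>"] by simp
  qed
  then have price: "price G (x(i := z)) t \<omega> =
      price G x t \<omega> - slope G t \<omega> * (net_discharge z t \<omega> - net_discharge (x i) t \<omega>)" for t \<omega>
    by (simp only: price_def) (simp add: algebra_simps)
  have "total G (\<lambda>t \<omega>. net_discharge z t \<omega> * price G (x(i := z)) t \<omega>)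
      - total G (\<lambda>t \<omega>. net_discharge (x i) t \<omega> * price G x t \<omega>) =
    total G (\<lambda>t \<omega>. (net_discharge z t \<omega> - net_discharge (x i) t \<omega>) *
       (price G x t \<omega> - slope G t \<omega> * net_discharge (x i) t \<omega>)) - quad G (x i) z"
    unfolding quad_def total_diff[symmetric] price
    by (intro total_cong) (simp add: power2_eq_square algebra_simps)
  then show ?thesis
    by (simp add: profit_eq own_derivative_def)
qed

section \<open>Quadratic expansion of the objective\<close>

text \<open>With D the total net discharge and E the sum of the individual squares, revenues
  contribute -a D^2 and the pairs a (D^2 - E) / 2. What remains is -a (D^2 + E) / 2, a negative
  semidefinite form.\<close>

lemma objective_eq:
  "objective G x =
     total G (\<lambda>t \<omega>. base_price G t \<omega> * (\<Sum>i\<in>investors G. net_discharge (x i) t \<omega>)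
       - slope G t \<omega> / 2 * ((\<Sum>i\<in>investors G. net_discharge (x i) t \<omega>)\<^sup>2
           + (\<Sum>i\<in>investors G. (net_discharge (x i) t \<omega>)\<^sup>2)))
     - (\<Sum>i\<in>investors G. cost G i (x i))"
proof -
  define D where "D t \<omega> = (\<Sum>i\<in>investors G. net_discharge (x i) t \<omega>)" for t \<omega>
  define E where "E t \<omega> = (\<Sum>i\<in>investors G. (net_discharge (x i) t \<omega>)\<^sup>2)" for t \<omega>
  let ?P = "{(i, j). 1 \<le> i \<and> i < j \<and> j \<le> num_investors G}"
  have pairs: "(\<Sum>(i, j)\<in>?P. slope G t \<omega> * cross_term (x i) (x j) t \<omega>) =
      slope G t \<omega> * (((D t \<omega>)\<^sup>2 - E t \<omega>) / 2)" for t \<omega>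
    using sum_square_pairs[of "\<lambda>i. net_discharge (x i) t \<omega>" "num_investors G"]
    by (simp add: D_def E_def investors_def cross_term_def split_beta sum_distrib_left[symmetric])
  have "objective G x = total G (\<lambda>t \<omega>. D t \<omega> * price G x t \<omega>) - (\<Sum>i\<in>investors G. cost G i (x i))
      + total G (\<lambda>t \<omega>. slope G t \<omega> * (((D t \<omega>)\<^sup>2 - E t \<omega>) / 2))"
    unfolding objective_def profit_eq pairs
    by (simp add: total_def[symmetric] sum_subtractf total_sum[symmetric] D_def sum_distrib_right)
  also have "\<dots> = total G (\<lambda>t \<omega>. D t \<omega> * price G x t \<omega> + slope G t \<omega> * (((D t \<omega>)\<^sup>2 - E t \<omega>) / 2))
      - (\<Sum>i\<in>investors G. cost G i (x i))"
    by (simp add: total_add)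
  also have "(\<lambda>t \<omega>. D t \<omega> * price G x t \<omega> + slope G t \<omega> * (((D t \<omega>)\<^sup>2 - E t \<omega>) / 2)) =
      (\<lambda>t \<omega>. base_price G t \<omega> * D t \<omega> - slope G t \<omega> / 2 * ((D t \<omega>)\<^sup>2 + E t \<omega>))"
    by (simp add: price_def D_def[symmetric] power2_eq_square field_simps)
  finally show ?thesis
    by (simp add: D_def E_def)
qed

text \<open>Differentiating -a (D^2 + E) / 2 in d_i gives -a D - a d_i. Together with the base price
  this is exactly the factor in \<open>own_derivative\<close>, so the linear part splits into the
  investors' own derivatives.\<close>

lemma objective_deviation:
  fixes G :: "('w::finite) storage_game"
  shows "objective G y - objective G x =
     (\<Sum>i\<in>investors G. own_derivative G i x (y i))
     - (total G (\<lambda>t \<omega>. slope G t \<omega> *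
           (\<Sum>i\<in>investors G. net_discharge (y i) t \<omega> - net_discharge (x i) t \<omega>)\<^sup>2)
        + (\<Sum>i\<in>investors G. quad G (x i) (y i))) / 2"
proof -
  let ?dx = "\<lambda>i t \<omega>. net_discharge (x i) t \<omega>"
  let ?dy = "\<lambda>i t \<omega>. net_discharge (y i) t \<omega>"
  let ?N = "investors G"
  define h where "h z = (\<lambda>t \<omega>. base_price G t \<omega> * (\<Sum>i\<in>?N. net_discharge (z i) t \<omega>)
       - slope G t \<omega> / 2 * ((\<Sum>i\<in>?N. net_discharge (z i) t \<omega>)\<^sup>2
           + (\<Sum>i\<in>?N. (net_discharge (z i) t \<omega>)\<^sup>2)))" for z :: "'w profile"
  have pointwise: "h y t \<omega> - h x t \<omega> =
      (\<Sum>i\<in>?N. (?dy i t \<omega> - ?dx i t \<omega>) * (price G x t \<omega> - slope G t \<omega> * ?dx i t \<omega>))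
      - 1 / 2 * (slope G t \<omega> * (\<Sum>i\<in>?N. ?dy i t \<omega> - ?dx i t \<omega>)\<^sup>2
          + (\<Sum>i\<in>?N. slope G t \<omega> * (?dy i t \<omega> - ?dx i t \<omega>)\<^sup>2))" for t \<omega>
  proof -
    \<comment> \<open>Naming the sums reduces the claim to a polynomial identity in scalars, in
      which \<open>XY\<close> cancels.\<close>
    define X Y XX YY XY a where defs: "X = (\<Sum>i\<in>?N. ?dx i t \<omega>)" "Y = (\<Sum>i\<in>?N. ?dy i t \<omega>)"
      "XX = (\<Sum>i\<in>?N. (?dx i t \<omega>)\<^sup>2)" "YY = (\<Sum>i\<in>?N. (?dy i t \<omega>)\<^sup>2)"
      "XY = (\<Sum>i\<in>?N. ?dx i t \<omega> * ?dy i t \<omega>)" "a = slope G t \<omega>"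
    \<comment> \<open>Stated for an arbitrary \<open>p\<close>, since the price is common to all
      investors and factors out of the sum.\<close>
    have 1: "(\<Sum>i\<in>?N. (?dy i t \<omega> - ?dx i t \<omega>) * (p - a * ?dx i t \<omega>)) = p * (Y - X) - a * (XY - XX)" for p
      unfolding defs
      by (simp add: sum_distrib_left sum_subtractf[symmetric] power2_eq_square algebra_simps)
    have 2: "(\<Sum>i\<in>?N. a * (?dy i t \<omega> - ?dx i t \<omega>)\<^sup>2) = a * (YY - 2 * XY + XX)"
      unfolding defs
      by (simp add: sum_distrib_left sum_subtractf[symmetric] sum.distrib[symmetric]
          power2_eq_square algebra_simps)
    show ?thesis
      unfolding h_def defs(6)[symmetric] 1 2 sum_subtractf price_def
      unfolding defs(1-4)[symmetric]
      by (simp add: power2_eq_square field_simps)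
  qed
  have "objective G y - objective G x =
      total G (\<lambda>t \<omega>. h y t \<omega> - h x t \<omega>) - (\<Sum>i\<in>?N. cost G i (y i) - cost G i (x i))"
    unfolding objective_eq[of G y] objective_eq[of G x] h_def total_diff sum_subtractf by simp
  then show ?thesis
    unfolding pointwise total_diff total_cmult total_add total_sum
    by (simp add: own_derivative_def quad_def sum_subtractf)
qed

section \<open>Concavity of the objective\<close>

lemma objective_le_linearization:
  assumes "storage_game G"
  shows "objective G y \<le> objective G x + (\<Sum>i\<in>investors G. own_derivative G i x (y i))"
proof -
  have "0 \<le> total G (\<lambda>t \<omega>. slope G t \<omega> *
      (\<Sum>i\<in>investors G. net_discharge (y i) t \<omega> - net_discharge (x i) t \<omega>)\<^sup>2)"
    using assms by (intro total_nonneg) (auto simp: storage_game_def less_imp_le)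
  moreover have "0 \<le> (\<Sum>i\<in>investors G. quad G (x i) (y i))"
    using assms by (intro sum_nonneg quad_nonneg)
  ultimately show ?thesis
    using objective_deviation[of G y x] by argo
qed

text \<open>The linearization is taken at the convex combination \<open>z\<close> itself: its linear
  part \<open>L\<close> is affine and vanishes at \<open>z\<close>, so the weighted bounds at
  \<open>x\<close> and \<open>y\<close> add up to the claim.\<close>

lemma concave_on_objective:
  fixes G :: "('w::finite) storage_game"
  assumes "storage_game G"
  shows "concave_on (profiles G) (objective G)"
  unfolding concave_on_iff
proof (intro conjI ballI allI impI convex_profiles)
  fix x y :: "'w profile" and u v :: real
  assume uv: "0 \<le> u" "0 \<le> v" "u + v = 1"
  define z where "z = u *\<^sub>R x + v *\<^sub>R y"
  define L where "L w = (\<Sum>i\<in>investors G. own_derivative G i z (w i))" for w :: "'w profile"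
  have "u * L x + v * L y = (\<Sum>i\<in>investors G. own_derivative G i z (u *\<^sub>R x i + v *\<^sub>R y i))"
    using uv by (simp add: L_def own_derivative_affine sum.distrib sum_distrib_left)
  also have "\<dots> = (\<Sum>i\<in>investors G. own_derivative G i z (z i))"
    by (simp add: z_def scaleR_fun_def)
  finally have L0: "u * L x + v * L y = 0"
    by (simp add: own_derivative_self)
  have "u * objective G x + v * objective G y \<le> u * (objective G z + L x) + v * (objective G z + L y)"
    unfolding L_def using assms uv
    by (intro add_mono mult_left_mono objective_le_linearization)
  also have "\<dots> = (u + v) * objective G z + (u * L x + v * L y)"
    by (simp add: algebra_simps)
  finally show "u * objective G x + v * objective G y \<le> objective G (u *\<^sub>R x + v *\<^sub>R y)"
    using uv L0 by (simp add: z_def)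
qed

section \<open>Equilibria and maximizers\<close>

text \<open>When only \<open>i\<close> moves, the squared sum of changes and the sum of squared
  changes coincide, so half of their total is the single \<open>quad\<close> term of the profit
  expansion.\<close>

lemma objective_exact_potential:
  assumes i: "i \<in> investors G"
  shows "objective G (x(i := z)) - objective G x = profit G i (x(i := z)) - profit G i x"
proof -
  \<comment> \<open>Every other component is unchanged and its summand vanishes there.\<close>
  have only_i: "(\<Sum>j\<in>investors G. k j ((x(i := z)) j)) = k i z"
    if "\<And>j. k j (x j) = (0::real)" for k
  proof -
    have "(\<Sum>j\<in>investors G. k j ((x(i := z)) j)) = (\<Sum>j\<in>investors G. if i = j then k j z else 0)"
      using that by (intro sum.cong) auto
    then show ?thesis
      using i by (simp add: investors_def)
  qed
  have "(\<Sum>j\<in>investors G. net_discharge ((x(i := z)) j) t \<omega> - net_discharge (x j) t \<omega>) =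
      net_discharge z t \<omega> - net_discharge (x i) t \<omega>" for t \<omega>
    by (rule only_i[of "\<lambda>j w. net_discharge w t \<omega> - net_discharge (x j) t \<omega>"]) simp
  then have "total G (\<lambda>t \<omega>. slope G t \<omega> *
      (\<Sum>j\<in>investors G. net_discharge ((x(i := z)) j) t \<omega> - net_discharge (x j) t \<omega>)\<^sup>2) = quad G (x i) z"
    by (simp only: quad_def)
  then show ?thesis
    unfolding objective_deviation profit_deviation[OF i]
    by (simp only: only_i[of "\<lambda>j. own_derivative G j x"] only_i[of "\<lambda>j. quad G (x j)"]
        own_derivative_self quad_self) simp
qed

text \<open>First-order condition: for a small step towards \<open>y\<close> the gain is linear in
  the step length and the loss only quadratic, so a positive derivative would make some step
  profitable.\<close>

lemma pure_nash_own_derivative_nonpos: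
  assumes nash: "pure_nash G x" and i: "i \<in> investors G" and y: "y \<in> strategy_set G i"
  shows "own_derivative G i x y \<le> 0"
proof -
  have bound: "own_derivative G i x y \<le> s * quad G (x i) y" if s: "0 < s" "s \<le> 1" for s
  proof -
    \<comment> \<open>A step of relative length \<open>s\<close> towards \<open>y\<close>, feasible
      by convexity.\<close>
    let ?z = "(1 - s) *\<^sub>R x i + s *\<^sub>R y"
    have "x i \<in> strategy_set G i"
      using nash i by (auto simp: pure_nash_def profiles_def)
    then have "?z \<in> strategy_set G i"
      using y s by (intro convexD[OF convex_strategy_set]) auto
    then have "profit G i (x(i := ?z)) - profit G i x \<le> 0"
      using nash i by (simp add: pure_nash_def)
    then have "s * own_derivative G i x y \<le> s\<^sup>2 * quad G (x i) y"
      unfolding profit_deviation[OF i] quad_towards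
      by (simp add: own_derivative_affine own_derivative_self)
    then show ?thesis
      using s by (simp add: power2_eq_square mult.assoc)
  qed
  have "((\<lambda>s. s * quad G (x i) y) \<longlongrightarrow> 0 * quad G (x i) y) (at_right 0)"
    by (intro tendsto_intros)
  moreover have "\<forall>\<^sub>F s in at_right 0. own_derivative G i x y \<le> s * quad G (x i) y"
    using bound by (auto simp: eventually_at_right_field intro!: exI[of _ 1])
  ultimately show ?thesis
    by (intro tendsto_lowerbound[of _ _ "at_right (0::real)"]) auto
qed

theorem theorem1:
  fixes G :: "('w::finite) storage_game"
  assumes "storage_game G"
  shows "convex (profiles G) \<and> concave_on (profiles G) (objective G) \<and>
         (\<forall>x\<in>profiles G.
           pure_nash G x \<longleftrightarrow> is_arg_max (objective G) (\<lambda>y. y \<in> profiles G) x)"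
proof (intro conjI ballI iffI)
  show "convex (profiles G)" by (rule convex_profiles)
  show "concave_on (profiles G) (objective G)" using assms by (rule concave_on_objective)
next
  fix x
  assume x: "x \<in> profiles G" and nash: "pure_nash G x"
  \<comment> \<open>The first-order conditions of all investors bound the linear part of a joint
    deviation, and the quadratic part only lowers the objective.\<close>
  have "objective G y \<le> objective G x" if "y \<in> profiles G" for y
  proof -
    have "(\<Sum>i\<in>investors G. own_derivative G i x (y i)) \<le> 0"
      using that nash
      by (intro sum_nonpos pure_nash_own_derivative_nonpos) (auto simp: profiles_def)
    then show ?thesis
      using objective_le_linearization[OF assms, of y x] by linarith
  qed
  then show "is_arg_max (objective G) (\<lambda>y. y \<in> profiles G) x"
    using x by (auto simp: is_arg_max_linorder)
next
  fix x
  assume x: "x \<in> profiles G" and opt: "is_arg_max (objective G) (\<lambda>y. y \<in> profiles G) x"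
  have "profit G i (x(i := y)) \<le> profit G i x"
    if i: "i \<in> investors G" and y: "y \<in> strategy_set G i" for i y
  proof -
    \<comment> \<open>Feasibility is a product of individual constraints, so a unilateral deviation
      competes in the joint problem.\<close>
    have "x(i := y) \<in> profiles G"
      using x i y unfolding profiles_def
      by (auto simp: PiE_iff extensional_def)
    then have "objective G (x(i := y)) \<le> objective G x"
      using opt by (auto simp: is_arg_max_linorder)
    then show ?thesis
      using objective_exact_potential[OF i, of x y] by linarith
  qed
  then show "pure_nash G x"
    using x by (auto simp: pure_nash_def)
qed

end
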